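(* 1. Assume (C1) and (C2). If $\nu$ belongs to $\bar{\mathcal F}$, then, for every $y\in\mathcal Y$, $\varphi_y(\nu)$ and $\psi(\nu)$ both belong to $\bar{\mathcal F}$. More precisely, if $\nu=\nu_{\theta,\alpha}$ with $\theta\in\Theta$, $\alpha\in S$, then $$\varphi_y(\nu)=\nu_{T_y(\theta),\,a_y(\theta,\alpha)},\qquad \psi(\nu)=\nu_{\tau(\theta),\,b(\theta,\alpha)},$$ where $T_y(\theta)$ and $\tau(\theta)$ are the parameters given by (C1) and (C2), and the mixture parameters $a_y(\theta,\alpha)$ and $b(\theta,\alpha)$ are given, for $j\ge 0$, by $$a_y(\theta,\alpha)_j=\frac{\alpha_{t_y^{-1}(j)}\;p_{\nu_\theta^{t_y^{-1}(j)}}(y)}{p_\nu(y)}$$ (understood as $0$ when $j$ is not in the range of $t_y$) and $$b(\theta,\alpha)_j=\sum_{i\ge 0}\alpha_i\,\alpha_j^{(i,\theta)} .$$ When moreover (C2-f) holds and $l(\alpha)=N<\infty$, the latter becomes $$b(\theta,\alpha)_j=\sum_{i=0}^{N}\alpha_i\,\alpha_j^{(i,\theta)}\,1_{(j\le L(i))}=\sum_{L^{-1}(j)\le i\le N}\alpha_i\,\alpha_j^{(i,\theta)},\qquad L^{-1}(j)=\inf\{i: L(i)\ge j\}.$$ 2. Assume (C1) and (C2-f). If $\nu$ belongs to $\bar{\mathcal F}_f$, then, for every $y\in\mathcal Y$, $\varphi_y(\nu)$ and $\psi(\nu)$ both belong to $\bar{\mathcal F}_f$.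
   Context: Here $\mathbb N=\{0,1,2,\dots\}$. $(\mathcal X,\mathcal B)$ and $(\mathcal Y,\mathcal C)$ are measurable spaces (state spaces of a hidden time-homogeneous Markov chain $(x_n)$ and of the observations $(y_n)$), $P(x,dx')$ is the transition operator of $(x_n)$ on $\mathcal X$, and the conditional distribution of $y_n$ given $x_n=x$ is $F_x(dy)=f_x(y)\mu(dy)$, with $\mu$ a common dominating measure on $\mathcal Y$. For a probability measure $\nu$ on $\mathcal X$, set - $p_\nu(y)=\int_{\mathcal X}\nu(d\xi)f_\xi(y)$ (marginal density), - $\varphi_y(\nu)(dx)=f_x(y)\nu(dx)/p_\nu(y)$ (updating operator, with the convention $0/0=0$), - $\psi(\nu)(dx')=\nu P(dx')=\int_{\mathcal X}\nu(dx)P(x,dx')$ (prediction operator). Let $\Theta\subset\mathbb R^d$ be a parameter set and let $\mathcal F=\{\nu_\theta^i:\theta\in\Theta,\ i\in\mathbb N\}$ be a class of probability measures on $\mathcal X$, with $(i,\theta)\mapsto\nu_\theta^i$ one-to-one. Let $$S=\Big\{\alpha=(\alpha_i)_{i\ge 0}:\ \alpha_i\ge 0\ \forall i,\ \sum_{i\ge 0}\alpha_i=1\Big\}.$$ For $\theta\in\Theta$ and $\alpha\in S$ put $\nu_{\theta,\alpha}=\sum_{i\ge 0}\alpha_i\nu_\theta^i$, and $\bar{\mathcal F}=\{\nu_{\theta,\alpha}:\theta\in\Theta,\alpha\in S\}$. The length of $\alpha$ is $l(\alpha)=\sup\{i:\alpha_i>0\}$, and $\bar{\mathcal F}_f=\{\nu_{\theta,\alpha}\in\bar{\mathcal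 F}: l(\alpha)<\infty\}$. Conditions: - (C1): for all $y\in\mathcal Y$ and all $\nu\in\mathcal F$, $\varphi_y(\nu)\in\mathcal F$; more precisely, for all $(i,\theta)\in\mathbb N\times\Theta$, $\varphi_y(\nu_\theta^i)=\nu_{T_y(\theta)}^{t_y(i)}$, with $T_y(\theta)\in\Theta$, $t_y:\mathbb N\to\mathbb N$ a one-to-one mapping (not depending on $\theta$), and $(\theta,y)\mapsto T_y(\theta)$ measurable. - (C2): for all $\nu\in\mathcal F$, $\psi(\nu)\in\bar{\mathcal F}$; more precisely, for all $(i,\theta)\in\mathbb N\times\Theta$, $\psi(\nu_\theta^i)=\sum_{j\ge 0}\alpha_j^{(i,\theta)}\nu_{\tau(\theta)}^j$, with $\alpha^{(i,\theta)}\in S$, $\tau(\theta)\in\Theta$, and $\theta\mapsto(\tau(\theta),\alpha^{(i,\theta)})$ measurable. - (C2-f): for all $\nu\in\mathcal F$, $\psi(\nu)\in\bar{\mathcal F}_f$, with, in the notation of (C2), $l(\alpha^{(i,\theta)})=L(i)<\infty$ for all $(i,\theta)$, and $i\mapsto L(i)$ non-decreasing.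
   Formalization: In part 1, the claims that φ_y(ν) belongs to F̄ (and a_y to S) are made only when p_ν(y) is finite; if p_ν(y) = ∞, which (C1) and (C2) allow for infinite mixtures, φ_y(ν) is the null measure and the claim fails. *)

theory Defs
  imports "HOL-Probability.Probability"
begin

text \<open>
  The measures \<open>X\<close> and \<open>Y\<close> below only serve as the measurable spaces
  \<open>(\<X>, \<B>)\<close> and \<open>(\<Y>, \<C>)\<close>. The conditional law of the observation given the hidden
  state \<open>x\<close> is \<open>f x\<close> times \<open>\<mu>\<close>, a Markov kernel from \<open>X\<close> to \<open>Y\<close>; the dominating measure
  is not required to be sigma-finite. Joint measurability of \<open>f\<close> is the usual implicit
  requirement making the marginal densities meaningful.
\<close>

locale hidden_markov_model =
  fixes X :: "'x measure" and Y :: "'y measure" and \<mu> :: "'y measure"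
    and f :: "'x \<Rightarrow> 'y \<Rightarrow> real" and P :: "'x \<Rightarrow> 'x measure"
  assumes transition: "P \<in> X \<rightarrow>\<^sub>M prob_algebra X"
    and sets_dominating: "sets \<mu> = sets Y"
    and density_nonneg: "\<And>x y. x \<in> space X \<Longrightarrow> y \<in> space Y \<Longrightarrow> 0 \<le> f x y"
    and density_measurable: "(\<lambda>(x, y). f x y) \<in> borel_measurable (X \<Otimes>\<^sub>M Y)"
    and emission: "(\<lambda>x. density \<mu> (\<lambda>y. ennreal (f x y))) \<in> X \<rightarrow>\<^sub>M prob_algebra Y"

text \<open>
  \<open>\<nu> \<theta> i\<close> is the probability measure with parameter \<open>\<theta>\<close> and index \<open>i\<close>; its values for
  \<open>\<theta>\<close> outside \<open>\<Theta>\<close> are irrelevant.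
\<close>

locale parametric_class =
  fixes X :: "'x measure" and \<Theta> :: "(real ^ 'd) set"
    and \<nu> :: "real ^ 'd \<Rightarrow> nat \<Rightarrow> 'x measure"
  assumes prob: "\<And>\<theta> i. \<theta> \<in> \<Theta> \<Longrightarrow> \<nu> \<theta> i \<in> space (prob_algebra X)"
    and one_to_one: "inj_on (\<lambda>(i, \<theta>). \<nu> \<theta> i) (UNIV \<times> \<Theta>)"

definition marginal_density :: "('x \<Rightarrow> 'y \<Rightarrow> real) \<Rightarrow> 'x measure \<Rightarrow> 'y \<Rightarrow> ennreal" where
  "marginal_density f \<nu> y = (\<integral>\<^sup>+ \<xi>. ennreal (f \<xi> y) \<partial>\<nu>)"

text \<open>
  The quotient is taken in \<^typ>\<open>ennreal\<close>, where \<open>0 / 0 = 0\<close>. When the marginal density is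
  infinite the quotient is \<open>0\<close> and the result is the null measure, not a probability measure.
\<close>

definition update :: "('x \<Rightarrow> 'y \<Rightarrow> real) \<Rightarrow> 'y \<Rightarrow> 'x measure \<Rightarrow> 'x measure" where
  "update f y \<nu> = density \<nu> (\<lambda>x. ennreal (f x y) / marginal_density f \<nu> y)"

definition predict :: "('x \<Rightarrow> 'x measure) \<Rightarrow> 'x measure \<Rightarrow> 'x measure" where
  "predict P \<nu> = \<nu> \<bind> P"

text \<open>The set \<open>S\<close> of mixture weights.\<close>

definition weights :: "(nat \<Rightarrow> real) set" where
  "weights = {\<alpha>. (\<forall>i. 0 \<le> \<alpha> i) \<and> \<alpha> sums 1}"

definition mixture ::
  "'x measure \<Rightarrow> ('p \<Rightarrow> nat \<Rightarrow> 'x measure) \<Rightarrow> 'p \<Rightarrow> (nat \<Rightarrow> real) \<Rightarrow> 'x measure" where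
  "mixture X \<nu> \<theta> \<alpha> =
     measure_of (space X) (sets X) (\<lambda>B. \<Sum>i. ennreal (\<alpha> i) * emeasure (\<nu> \<theta> i) B)"

definition weight_length :: "(nat \<Rightarrow> real) \<Rightarrow> enat" where
  "weight_length \<alpha> = Sup (enat ` {i. \<alpha> i > 0})"

definition mixtures ::
  "'x measure \<Rightarrow> 'p set \<Rightarrow> ('p \<Rightarrow> nat \<Rightarrow> 'x measure) \<Rightarrow> 'x measure set" where
  "mixtures X \<Theta> \<nu> = {mixture X \<nu> \<theta> \<alpha> | \<theta> \<alpha>. \<theta> \<in> \<Theta> \<and> \<alpha> \<in> weights}"

definition finite_mixtures ::
  "'x measure \<Rightarrow> 'p set \<Rightarrow> ('p \<Rightarrow> nat \<Rightarrow> 'x measure) \<Rightarrow> 'x measure set" where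
  "finite_mixtures X \<Theta> \<nu> =
     {mixture X \<nu> \<theta> \<alpha> | \<theta> \<alpha>. \<theta> \<in> \<Theta> \<and> \<alpha> \<in> weights \<and> weight_length \<alpha> < \<infinity>}"

text \<open>
  \<open>\<Theta>\<close> carries the trace of the Borel sets, and the set of weights the trace of the product
  sigma-algebra on real sequences.
\<close>

definition condition_C1 ::
  "'y measure \<Rightarrow> ('x \<Rightarrow> 'y \<Rightarrow> real) \<Rightarrow> (real ^ 'd) set \<Rightarrow> (real ^ 'd \<Rightarrow> nat \<Rightarrow> 'x measure) \<Rightarrow>
   ('y \<Rightarrow> real ^ 'd \<Rightarrow> real ^ 'd) \<Rightarrow> ('y \<Rightarrow> nat \<Rightarrow> nat) \<Rightarrow> bool" where
  "condition_C1 Y f \<Theta> \<nu> T t \<longleftrightarrow>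
     (\<forall>y\<in>space Y. inj (t y) \<and>
        (\<forall>\<theta>\<in>\<Theta>. T y \<theta> \<in> \<Theta> \<and> (\<forall>i. update f y (\<nu> \<theta> i) = \<nu> (T y \<theta>) (t y i)))) \<and>
     (\<lambda>(\<theta>, y). T y \<theta>) \<in> restrict_space borel \<Theta> \<Otimes>\<^sub>M Y \<rightarrow>\<^sub>M restrict_space borel \<Theta>"

definition condition_C2 ::
  "'x measure \<Rightarrow> ('x \<Rightarrow> 'x measure) \<Rightarrow> (real ^ 'd) set \<Rightarrow> (real ^ 'd \<Rightarrow> nat \<Rightarrow> 'x measure) \<Rightarrow>
   (real ^ 'd \<Rightarrow> real ^ 'd) \<Rightarrow> (nat \<Rightarrow> real ^ 'd \<Rightarrow> nat \<Rightarrow> real) \<Rightarrow> bool" where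
  "condition_C2 X P \<Theta> \<nu> \<tau> A \<longleftrightarrow>
     (\<forall>\<theta>\<in>\<Theta>. \<tau> \<theta> \<in> \<Theta> \<and>
        (\<forall>i. A i \<theta> \<in> weights \<and> predict P (\<nu> \<theta> i) = mixture X \<nu> (\<tau> \<theta>) (A i \<theta>))) \<and>
     (\<forall>i. (\<lambda>\<theta>. (\<tau> \<theta>, A i \<theta>)) \<in> restrict_space borel \<Theta> \<rightarrow>\<^sub>M
        restrict_space borel \<Theta> \<Otimes>\<^sub>M restrict_space (\<Pi>\<^sub>M j\<in>UNIV. borel) weights)"

definition condition_C2f ::
  "'x measure \<Rightarrow> ('x \<Rightarrow> 'x measure) \<Rightarrow> (real ^ 'd) set \<Rightarrow> (real ^ 'd \<Rightarrow> nat \<Rightarrow> 'x measure) \<Rightarrow>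
   (real ^ 'd \<Rightarrow> real ^ 'd) \<Rightarrow> (nat \<Rightarrow> real ^ 'd \<Rightarrow> nat \<Rightarrow> real) \<Rightarrow> (nat \<Rightarrow> nat) \<Rightarrow> bool" where
  "condition_C2f X P \<Theta> \<nu> \<tau> A L \<longleftrightarrow>
     condition_C2 X P \<Theta> \<nu> \<tau> A \<and>
     (\<forall>i. \<forall>\<theta>\<in>\<Theta>. weight_length (A i \<theta>) = enat (L i)) \<and> mono L"

definition update_weights ::
  "'x measure \<Rightarrow> ('x \<Rightarrow> 'y \<Rightarrow> real) \<Rightarrow> ('p \<Rightarrow> nat \<Rightarrow> 'x measure) \<Rightarrow> ('y \<Rightarrow> nat \<Rightarrow> nat) \<Rightarrow>
   'y \<Rightarrow> 'p \<Rightarrow> (nat \<Rightarrow> real) \<Rightarrow> nat \<Rightarrow> real" where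
  "update_weights X f \<nu> t y \<theta> \<alpha> j =
     (if j \<in> range (t y)
      then enn2real (ennreal (\<alpha> (inv (t y) j)) * marginal_density f (\<nu> \<theta> (inv (t y) j)) y
             / marginal_density f (mixture X \<nu> \<theta> \<alpha>) y)
      else 0)"

definition predict_weights ::
  "(nat \<Rightarrow> 'p \<Rightarrow> nat \<Rightarrow> real) \<Rightarrow> 'p \<Rightarrow> (nat \<Rightarrow> real) \<Rightarrow> nat \<Rightarrow> real" where
  "predict_weights A \<theta> \<alpha> j = (\<Sum>i. \<alpha> i * A i \<theta> j)"

text \<open>Valued in \<^typ>\<open>enat\<close> because \<open>L\<close> may stay below \<open>j\<close>; the infimum is then \<open>\<infinity>\<close>.\<close>

definition generalized_inverse :: "(nat \<Rightarrow> nat) \<Rightarrow> nat \<Rightarrow> enat" where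
  "generalized_inverse L j = Inf (enat ` {i. L i \<ge> j})"

end

(*
  Both operators are, up to normalisation, integrals against the given measure, and such integrals
  are linear in the weights. For the update the normalising constant of the mixture differs from
  those of the components, which reweights component i by p_i(y) / p(y). Condition (C1) forces every
  p_i(y) to lie strictly between 0 and infinity: otherwise the updated component would be null and
  not a probability measure.
*)
theory Submission
  imports Defs
begin

section \<open>Mixture weights\<close>

lemma weights_nonneg: "\<alpha> \<in> weights \<Longrightarrow> 0 \<le> \<alpha> i"
  by (simp add: weights_def)

text \<open>Every series converges in \<open>ennreal\<close>, so for nonnegative terms normalisation
  reduces to one equation about \<open>suminf\<close>. In this form series can be interchanged and
  reindexed freely.\<close>

lemma weights_iff_suminf:
  "\<alpha> \<in> weights \<longleftrightarrow> (\<forall>i. 0 \<le> \<alpha> i) \<and> (\<Sum>i. ennreal (\<alpha> i)) = 1"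
proof -
  have "(\<Sum>i. ennreal (\<alpha> i)) = ennreal 1 \<longleftrightarrow> (\<lambda>i. ennreal (\<alpha> i)) sums ennreal 1"
    by (simp only: sums_iff summableI simp_thms)
  also have "\<dots> \<longleftrightarrow> \<alpha> sums 1" if "\<forall>i. 0 \<le> \<alpha> i"
    using that by (intro sums_ennreal) auto
  finally show ?thesis
    by (auto simp only: weights_def mem_Collect_eq ennreal_1)
qed

lemma weights_le_1:
  assumes "\<alpha> \<in> weights"
  shows "\<alpha> i \<le> 1"
proof -
  have "\<alpha> sums 1" "\<forall>i. 0 \<le> \<alpha> i"
    using assms by (auto simp: weights_def)
  then have "sum \<alpha> {i} \<le> suminf \<alpha>"
    by (intro sum_le_suminf) (auto simp: sums_iff)
  with \<open>\<alpha> sums 1\<close> show ?thesis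
    by (simp add: sums_iff)
qed

lemma weights_exists_pos:
  assumes "\<alpha> \<in> weights"
  shows "\<exists>i. \<alpha> i > 0"
proof (rule ccontr)
  assume "\<not> ?thesis"
  then have "\<alpha> = (\<lambda>_. 0)"
    using weights_nonneg[OF assms] by (auto intro!: ext antisym simp: not_less)
  then show False
    using assms by (auto simp: weights_def sums_iff)
qed

lemma weight_length_le_iff: "weight_length \<alpha> \<le> enat N \<longleftrightarrow> (\<forall>i. \<alpha> i > 0 \<longrightarrow> i \<le> N)"
  by (auto simp: weight_length_def Sup_le_iff)

text \<open>A set of naturals is bounded iff it is finite. Finite support passes to subsets and
  images, which is how both operators are shown to preserve finite length.\<close>

lemma weight_length_finite_iff: "weight_length \<alpha> < \<infinity> \<longleftrightarrow> finite {i. \<alpha> i > 0}"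
proof
  assume "weight_length \<alpha> < \<infinity>"
  then obtain N where "weight_length \<alpha> = enat N"
    by (cases "weight_length \<alpha>") auto
  then have "{i. \<alpha> i > 0} \<subseteq> {..N}"
    using weight_length_le_iff[of \<alpha> N] by auto
  then show "finite {i. \<alpha> i > 0}"
    by (rule finite_subset) simp
next
  assume "finite {i. \<alpha> i > 0}"
  then obtain N where "\<forall>i\<in>{i. \<alpha> i > 0}. i \<le> N"
    using finite_nat_set_iff_bounded_le by blast
  then have "weight_length \<alpha> \<le> enat N"
    by (simp add: weight_length_le_iff)
  then show "weight_length \<alpha> < \<infinity>"
    using enat_ord_simps(4) order_le_less_trans by blast
qed

lemma weight_length_eq_enat_zero:
  assumes "\<alpha> \<in> weights" "weight_length \<alpha> = enat N" "N < i"
  shows "\<alpha> i = 0"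
  using weight_length_le_iff[of \<alpha> N] weights_nonneg[OF assms(1), of i] assms(2,3)
  by (auto simp: le_less)

text \<open>Monotonicity makes the set of \<open>i\<close> with \<open>j \<le> L i\<close> upward
  closed, so lying above its infimum means belonging to it. This matches the index range of the
  second finite sum with the indicator in the first.\<close>

lemma generalized_inverse_le_iff:
  assumes "mono L"
  shows "generalized_inverse L j \<le> enat i \<longleftrightarrow> j \<le> L i"
proof
  assume "j \<le> L i"
  then show "generalized_inverse L j \<le> enat i"
    unfolding generalized_inverse_def by (intro Inf_lower) auto
next
  assume le: "generalized_inverse L j \<le> enat i"
  \<comment> \<open>For an empty set the infimum is \<infinity>, which is not below a finite
    \<open>i\<close>.\<close>
  have "enat ` {i. L i \<ge> j} \<noteq> {}"
  proof
    assume "enat ` {i. L i \<ge> j} = {}"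
    with le show False
      unfolding generalized_inverse_def by (simp only: Inf_empty) (simp add: top_enat_def)
  qed
  \<comment> \<open>A nonempty set in \<open>enat\<close> is well ordered, so the infimum is
    attained.\<close>
  then have "generalized_inverse L j \<in> enat ` {i. L i \<ge> j}"
    unfolding generalized_inverse_def by (auto simp: Inf_enat_def intro: LeastI)
  then obtain k where "generalized_inverse L j = enat k" "j \<le> L k"
    by auto
  then show "j \<le> L i"
    using le monoD[OF assms, of k i] by auto
qed


section \<open>Mixture measures\<close>

text \<open>One of the two sums is read as an integral against the counting measure, and integrals
  of nonnegative functions commute with series.\<close>

lemma suminf_swap_ennreal:
  fixes g :: "nat \<Rightarrow> nat \<Rightarrow> ennreal"
  shows "(\<Sum>i. \<Sum>j. g i j) = (\<Sum>j. \<Sum>i. g i j)"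
  using nn_integral_suminf[of "\<lambda>i j. g j i" "count_space UNIV"]
  by (simp add: nn_integral_count_space_nat)

text \<open>Terms off the range of \<open>s\<close> vanish, and \<open>s\<close> is a bijection onto
  its range. It will be applied with \<open>s = t y\<close>, to pass from the old components to the
  updated ones.\<close>

lemma suminf_reindex_ennreal:
  fixes g h :: "nat \<Rightarrow> ennreal"
  assumes "inj s" "\<And>i. h (s i) = g i" "\<And>j. j \<notin> range s \<Longrightarrow> h j = 0"
  shows "(\<Sum>j. h j) = (\<Sum>i. g i)"
proof -
  have "(\<Sum>j. h j) = (\<integral>\<^sup>+j. h j \<partial>count_space UNIV)"
    by (simp add: nn_integral_count_space_nat)
  also have "\<dots> = (\<integral>\<^sup>+j. h j \<partial>count_space (range s))"
    using assms(3) by (intro nn_integral_count_space_eq) auto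
  also have "\<dots> = (\<integral>\<^sup>+i. h (s i) \<partial>count_space UNIV)"
    using assms(1) by (intro nn_integral_bij_count_space[symmetric]) (simp add: bij_betw_def)
  also have "\<dots> = (\<Sum>i. g i)"
    by (simp add: nn_integral_count_space_nat assms(2))
  finally show ?thesis .
qed

lemma sets_mixture [simp]: "sets (mixture X \<nu> \<theta> \<alpha>) = sets X"
  by (simp add: mixture_def sets.sigma_sets_eq sets.space_closed)

lemma space_mixture [simp]: "space (mixture X \<nu> \<theta> \<alpha>) = space X"
  by (rule sets_eq_imp_space_eq) simp

lemma measurable_mixture [simp]: "measurable (mixture X \<nu> \<theta> \<alpha>) N = measurable X N"
  by (rule measurable_cong_sets) auto

text \<open>\<open>measure_of\<close> returns the prescribed set function only once that is known to
  be countably additive; here this is an interchange of two nonnegative series.\<close>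

lemma emeasure_mixture:
  assumes "\<And>i. sets (\<nu> \<theta> i) = sets X" and B: "B \<in> sets X"
  shows "emeasure (mixture X \<nu> \<theta> \<alpha>) B = (\<Sum>i. ennreal (\<alpha> i) * emeasure (\<nu> \<theta> i) B)"
  unfolding mixture_def
proof (rule emeasure_measure_of_sigma)
  show "sigma_algebra (space X) (sets X)"
    by (rule sets.sigma_algebra_axioms)
  show "positive (sets X) (\<lambda>B. \<Sum>i. ennreal (\<alpha> i) * emeasure (\<nu> \<theta> i) B)"
    by (simp add: positive_def)
  show "countably_additive (sets X) (\<lambda>B. \<Sum>i. ennreal (\<alpha> i) * emeasure (\<nu> \<theta> i) B)"
  proof (rule countably_additiveI)
    fix C :: "nat \<Rightarrow> _" assume C: "range C \<subseteq> sets X" "disjoint_family C"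
    have "(\<Sum>n. \<Sum>i. ennreal (\<alpha> i) * emeasure (\<nu> \<theta> i) (C n))
        = (\<Sum>i. \<Sum>n. ennreal (\<alpha> i) * emeasure (\<nu> \<theta> i) (C n))"
      by (rule suminf_swap_ennreal)
    also have "\<dots> = (\<Sum>i. ennreal (\<alpha> i) * emeasure (\<nu> \<theta> i) (\<Union>n. C n))"
      using C assms(1) by (simp add: suminf_emeasure)
    finally show "(\<Sum>n. \<Sum>i. ennreal (\<alpha> i) * emeasure (\<nu> \<theta> i) (C n))
        = (\<Sum>i. ennreal (\<alpha> i) * emeasure (\<nu> \<theta> i) (\<Union>n. C n))" .
  qed
qed (rule B)

text \<open>The integral is linear in the measure: true for indicators, and stable under scaling,
  sums and increasing limits. Updating uses it for the likelihood, prediction for the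
  kernel.\<close>

lemma nn_integral_mixture:
  assumes sets: "\<And>i. sets (\<nu> \<theta> i) = sets X" and "g \<in> borel_measurable X"
  shows "(\<integral>\<^sup>+x. g x \<partial>mixture X \<nu> \<theta> \<alpha>) = (\<Sum>i. ennreal (\<alpha> i) * (\<integral>\<^sup>+x. g x \<partial>\<nu> \<theta> i))"
  using assms(2)
proof (induction g rule: borel_measurable_induct)
  case (cong f g)
  have "(\<integral>\<^sup>+x. f x \<partial>mixture X \<nu> \<theta> \<alpha>) = (\<integral>\<^sup>+x. g x \<partial>mixture X \<nu> \<theta> \<alpha>)"
    using cong(3) by (intro nn_integral_cong) simp
  moreover have "(\<integral>\<^sup>+x. f x \<partial>\<nu> \<theta> i) = (\<integral>\<^sup>+x. g x \<partial>\<nu> \<theta> i)" for i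
    using cong(3) sets_eq_imp_space_eq[OF sets, of i] by (intro nn_integral_cong) simp
  ultimately show ?case
    using cong(4) by simp
next
  case (set B)
  then show ?case
    using emeasure_mixture[of \<nu> \<theta> X B \<alpha>] sets by simp
next
  case (mult u c)
  have "u \<in> borel_measurable (\<nu> \<theta> i)" for i
    using mult.hyps(2) by (simp cong: measurable_cong_sets add: sets)
  then show ?case
    using mult by (simp add: nn_integral_cmult mult.left_commute)
next
  case (add u v)
  have "u \<in> borel_measurable (\<nu> \<theta> i)" "v \<in> borel_measurable (\<nu> \<theta> i)" for i
    using add.hyps by (simp_all cong: measurable_cong_sets add: sets)
  then show ?case
    using add by (simp add: nn_integral_add distrib_left suminf_add)
next
  case (seq U)
  have U: "U k \<in> borel_measurable (\<nu> \<theta> i)" for i k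
    using seq.hyps(1) by (simp cong: measurable_cong_sets add: sets)
  have Sup: "Sup (range U) x = (SUP k. U k x)" for x
    by (rule SUP_apply)
  have "(\<integral>\<^sup>+x. (SUP k. U k x) \<partial>mixture X \<nu> \<theta> \<alpha>)
      = (SUP k. \<integral>\<^sup>+x. U k x \<partial>mixture X \<nu> \<theta> \<alpha>)"
    using seq.hyps by (intro nn_integral_monotone_convergence_SUP) auto
  also have "\<dots> = (SUP k. \<Sum>i. ennreal (\<alpha> i) * (\<integral>\<^sup>+x. U k x \<partial>\<nu> \<theta> i))"
    using seq.IH by simp
  \<comment> \<open>Monotone convergence for the series itself: each term increases with
    \<open>k\<close>.\<close>
  also have "\<dots> = (\<Sum>i. SUP k. ennreal (\<alpha> i) * (\<integral>\<^sup>+x. U k x \<partial>\<nu> \<theta> i))"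
    using seq.hyps
    by (intro ennreal_suminf_SUP_eq[symmetric])
       (auto intro!: incseq_SucI mult_left_mono nn_integral_mono simp: incseq_Suc_iff le_fun_def)
  also have "\<dots> = (\<Sum>i. ennreal (\<alpha> i) * (SUP k. \<integral>\<^sup>+x. U k x \<partial>\<nu> \<theta> i))"
    by (simp add: SUP_mult_left_ennreal)
  also have "\<dots> = (\<Sum>i. ennreal (\<alpha> i) * (\<integral>\<^sup>+x. (SUP k. U k x) \<partial>\<nu> \<theta> i))"
    using seq.hyps U by (simp add: nn_integral_monotone_convergence_SUP)
  finally show ?case
    by (simp only: Sup seq.hyps)
qed


section \<open>Updating\<close>

text \<open>The normalising constant does not depend on the state, so it leaves the integral, even
  when it is 0 or \<infinity>.\<close>

lemma emeasure_update:
  assumes "(\<lambda>x. f x y) \<in> borel_measurable \<eta>" "B \<in> sets \<eta>"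
  shows "emeasure (update f y \<eta>) B
    = (\<integral>\<^sup>+x. ennreal (f x y) * indicator B x \<partial>\<eta>) / marginal_density f \<eta> y"
proof -
  have "emeasure (update f y \<eta>) B
      = (\<integral>\<^sup>+x. ennreal (f x y) / marginal_density f \<eta> y * indicator B x \<partial>\<eta>)"
    unfolding update_def using assms by (intro emeasure_density) auto
  also have "\<dots> = (\<integral>\<^sup>+x. ennreal (f x y) * indicator B x / marginal_density f \<eta> y \<partial>\<eta>)"
    by (simp add: divide_ennreal_def mult_ac)
  also have "\<dots> = (\<integral>\<^sup>+x. ennreal (f x y) * indicator B x \<partial>\<eta>) / marginal_density f \<eta> y"
    using assms by (intro nn_integral_divide) auto
  finally show ?thesis .
qed

text \<open>The updated measure has total mass \<open>p / p\<close>, which is \<open>0\<close> for \<open>p = 0\<close> and for \<open>p = \<infinity>\<close>.\<close>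

lemma marginal_density_pos_finite:
  assumes f: "(\<lambda>x. f x y) \<in> borel_measurable \<eta>" and "prob_space (update f y \<eta>)"
  shows "0 < marginal_density f \<eta> y" "marginal_density f \<eta> y < \<infinity>"
proof -
  have "(\<integral>\<^sup>+x. ennreal (f x y) * indicator (space \<eta>) x \<partial>\<eta>) = marginal_density f \<eta> y"
    unfolding marginal_density_def by (intro nn_integral_cong) simp
  moreover have "space (update f y \<eta>) = space \<eta>"
    by (simp add: update_def)
  ultimately have "marginal_density f \<eta> y / marginal_density f \<eta> y = 1"
    using emeasure_update[of f y, OF f, of "space \<eta>"] prob_space.emeasure_space_1[OF assms(2)] by simp
  then show "0 < marginal_density f \<eta> y" "marginal_density f \<eta> y < \<infinity>"
    by (auto simp: divide_eq_1_ennreal less_top[symmetric] zero_less_iff_neq_zero)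
qed

text \<open>One application of the update, with observation and parameter fixed;
  \<open>\<theta>'\<close> stands for \<open>T y \<theta>\<close>.\<close>

locale updatable_mixture =
  fixes X :: "'x measure" and f :: "'x \<Rightarrow> 'y \<Rightarrow> real" and \<nu> :: "'p \<Rightarrow> nat \<Rightarrow> 'x measure"
    and t :: "'y \<Rightarrow> nat \<Rightarrow> nat" and y :: 'y and \<theta> \<theta>' :: 'p and \<alpha> :: "nat \<Rightarrow> real"
  assumes f_measurable: "(\<lambda>x. f x y) \<in> borel_measurable X"
    and sets_\<nu>: "\<And>i. sets (\<nu> \<theta> i) = sets X" "\<And>i. sets (\<nu> \<theta>' i) = sets X"
    and prob_\<nu>': "\<And>i. prob_space (\<nu> \<theta>' i)"
    and inj_t: "inj (t y)"
    and update_\<nu>: "\<And>i. update f y (\<nu> \<theta> i) = \<nu> \<theta>' (t y i)"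
    and \<alpha>: "\<alpha> \<in> weights"
begin

abbreviation "p i \<equiv> marginal_density f (\<nu> \<theta> i) y"

abbreviation "q \<equiv> marginal_density f (mixture X \<nu> \<theta> \<alpha>) y"

abbreviation "a \<equiv> update_weights X f \<nu> t y \<theta> \<alpha>"

lemma f_measurable_\<nu>: "(\<lambda>x. f x y) \<in> borel_measurable (\<nu> \<theta> i)"
  using f_measurable by (simp cong: measurable_cong_sets add: sets_\<nu>)

text \<open>By (C1) the updated component is a member of the class, hence has total mass 1.\<close>

lemma p_pos: "0 < p i" and p_finite: "p i < \<infinity>"
  using marginal_density_pos_finite[of f y "\<nu> \<theta> i", OF f_measurable_\<nu>] prob_\<nu>'
  by (auto simp: update_\<nu>)

lemma q_eq: "q = (\<Sum>i. ennreal (\<alpha> i) * p i)"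
  unfolding marginal_density_def using sets_\<nu> f_measurable by (intro nn_integral_mixture) auto

text \<open>Some weight is positive, and its component alone already contributes a positive
  amount.\<close>

lemma q_pos: "0 < q"
proof -
  obtain i where "\<alpha> i > 0"
    using weights_exists_pos[OF \<alpha>] by auto
  then have "0 < ennreal (\<alpha> i) * p i"
    using p_pos[of i] by (simp add: ennreal_zero_less_mult_iff)
  also have "\<dots> \<le> q"
    unfolding q_eq using sum_le_suminf[of "\<lambda>i. ennreal (\<alpha> i) * p i" "{i}"] by simp
  finally show ?thesis .
qed

lemma ennreal_a: "ennreal (a (t y i)) = ennreal (\<alpha> i) * p i / q"
proof -
  \<comment> \<open>\<open>enn2real\<close> sends \<open>top\<close> to 0, so the quotient must be
    finite for the conversion to be undone. If \<open>q\<close> is infinite, the quotient is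
    0.\<close>
  have "ennreal (\<alpha> i) * p i / q < top"
    using p_finite[of i] q_pos
    by (auto simp: ennreal_divide_eq_top_iff ennreal_mult_eq_top_iff less_top[symmetric])
  then show ?thesis
    using inj_t by (simp add: update_weights_def)
qed

lemma a_outside_range: "j \<notin> range (t y) \<Longrightarrow> a j = 0"
  by (simp add: update_weights_def)

text \<open>Component \<open>i\<close> contributes \<open>p i\<close> times its own update, located
  at index \<open>t y i\<close>; division by \<open>q\<close> then gives its new weight. For
  infinite \<open>q\<close> both sides are the null measure.\<close>

lemma update_mixture: "update f y (mixture X \<nu> \<theta> \<alpha>) = mixture X \<nu> \<theta>' a"
proof (rule measure_eqI)
  show "sets (update f y (mixture X \<nu> \<theta> \<alpha>)) = sets (mixture X \<nu> \<theta>' a)"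
    by (simp add: update_def)
next
  fix B assume "B \<in> sets (update f y (mixture X \<nu> \<theta> \<alpha>))"
  then have B: "B \<in> sets X"
    by (simp add: update_def)
  have B_integral: "(\<integral>\<^sup>+x. ennreal (f x y) * indicator B x \<partial>\<nu> \<theta> i)
      = p i * emeasure (\<nu> \<theta>' (t y i)) B" (is "?I = _") for i
  proof -
    \<comment> \<open>Cancelling \<open>p i\<close> is legitimate because it lies strictly between 0
      and \<infinity>.\<close>
    have "?I = ?I * p i / p i"
      using p_pos[of i] p_finite[of i] by (intro mult_divide_eq_ennreal[symmetric]) auto
    also have "\<dots> = p i * (?I / p i)"
      by (simp only: ennreal_times_divide mult.commute)
    also have "?I / p i = emeasure (\<nu> \<theta>' (t y i)) B"
      using emeasure_update[of f y "\<nu> \<theta> i" B] f_measurable_\<nu> B sets_\<nu>(1)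
      by (simp add: update_\<nu>)
    finally show ?thesis .
  qed
  have "emeasure (update f y (mixture X \<nu> \<theta> \<alpha>)) B
      = (\<integral>\<^sup>+x. ennreal (f x y) * indicator B x \<partial>mixture X \<nu> \<theta> \<alpha>) / q"
    using f_measurable B by (intro emeasure_update) auto
  also have "\<dots> = (\<Sum>i. ennreal (\<alpha> i) * (p i * emeasure (\<nu> \<theta>' (t y i)) B)) / q"
    using f_measurable B sets_\<nu> by (subst nn_integral_mixture) (auto simp: B_integral)
  also have "\<dots> = (\<Sum>i. ennreal (\<alpha> i) * (p i * emeasure (\<nu> \<theta>' (t y i)) B) / q)"
    by (simp add: divide_ennreal_def)
  also have "\<dots> = (\<Sum>i. ennreal (a (t y i)) * emeasure (\<nu> \<theta>' (t y i)) B)"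
    by (simp add: ennreal_a divide_ennreal_def mult_ac)
  also have "\<dots> = (\<Sum>j. ennreal (a j) * emeasure (\<nu> \<theta>' j) B)"
    by (rule suminf_reindex_ennreal[OF inj_t, symmetric]) (auto simp: a_outside_range)
  also have "\<dots> = emeasure (mixture X \<nu> \<theta>' a) B"
    using sets_\<nu>(2) B by (simp add: emeasure_mixture)
  finally show "emeasure (update f y (mixture X \<nu> \<theta> \<alpha>)) B = emeasure (mixture X \<nu> \<theta>' a) B" .
qed

text \<open>The numerators add up to \<open>q\<close>, so the total is \<open>q / q\<close>. This is
  1 only for positive finite \<open>q\<close>; for infinite \<open>q\<close> all new weights
  vanish.\<close>

lemma update_weights_in_weights:
  assumes "q < \<infinity>"
  shows "a \<in> weights"
proof -
  have "(\<Sum>j. ennreal (a j)) = (\<Sum>i. ennreal (a (t y i)))"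
    by (rule suminf_reindex_ennreal[OF inj_t]) (auto simp: a_outside_range)
  also have "\<dots> = (\<Sum>i. ennreal (\<alpha> i) * p i) / q"
    by (simp add: ennreal_a divide_ennreal_def)
  also have "\<dots> = 1"
    using assms q_pos by (simp flip: q_eq)
  finally have "(\<Sum>j. ennreal (a j)) = 1" .
  moreover have "0 \<le> a j" for j
    by (simp add: update_weights_def)
  ultimately show ?thesis
    by (simp add: weights_iff_suminf)
qed

text \<open>The new support lies in the image under \<open>t y\<close> of the old one.\<close>

lemma weight_length_update_finite:
  assumes "weight_length \<alpha> < \<infinity>"
  shows "weight_length a < \<infinity>"
proof -
  have "{j. a j > 0} \<subseteq> t y ` {i. \<alpha> i > 0}"
  proof
    fix j assume "j \<in> {j. a j > 0}"
    then have pos: "0 < a j"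
      by simp
    then obtain i where j: "j = t y i"
      using a_outside_range[of j] by auto
    have "ennreal (\<alpha> i) \<noteq> 0"
    proof
      assume "ennreal (\<alpha> i) = 0"
      then have "ennreal (a j) = 0"
        unfolding j ennreal_a by simp
      with pos show False
        by (simp add: ennreal_eq_0_iff)
    qed
    then show "j \<in> t y ` {i. \<alpha> i > 0}"
      unfolding j by (auto simp: ennreal_eq_0_iff not_le)
  qed
  then show ?thesis
    using assms unfolding weight_length_finite_iff by (rule finite_surj[rotated])
qed

text \<open>A finite sum of finite terms. Thus finite mixtures automatically satisfy the condition
  under which the updated weights are normalised.\<close>

lemma marginal_density_mixture_finite:
  assumes "weight_length \<alpha> < \<infinity>"
  shows "q < \<infinity>"
proof -
  have "q = (\<Sum>i\<in>{i. \<alpha> i > 0}. ennreal (\<alpha> i) * p i)"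
    unfolding q_eq using assms
    by (intro suminf_finite) (auto simp: ennreal_neg not_less simp flip: weight_length_finite_iff)
  also have "\<dots> < \<infinity>"
    using assms p_finite unfolding weight_length_finite_iff
    by (simp add: ennreal_mult_less_top)
  finally show ?thesis .
qed

end


section \<open>Prediction\<close>

text \<open>One application of the prediction; \<open>\<theta>'\<close> stands for
  \<open>\<tau> \<theta>\<close>. A nonempty state space keeps \<open>bind\<close> away from its
  default value.\<close>

locale predictable_mixture =
  fixes X :: "'x measure" and P :: "'x \<Rightarrow> 'x measure" and \<nu> :: "'p \<Rightarrow> nat \<Rightarrow> 'x measure"
    and A :: "nat \<Rightarrow> 'p \<Rightarrow> nat \<Rightarrow> real" and \<theta> \<theta>' :: 'p and \<alpha> :: "nat \<Rightarrow> real"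
  assumes P_kernel: "P \<in> X \<rightarrow>\<^sub>M prob_algebra X"
    and sets_\<nu>: "\<And>i. sets (\<nu> \<theta> i) = sets X" "\<And>i. sets (\<nu> \<theta>' i) = sets X"
    and nonempty: "space X \<noteq> {}"
    and A_weights: "\<And>i. A i \<theta> \<in> weights"
    and predict_\<nu>: "\<And>i. predict P (\<nu> \<theta> i) = mixture X \<nu> \<theta>' (A i \<theta>)"
    and \<alpha>: "\<alpha> \<in> weights"
begin

abbreviation "b \<equiv> predict_weights A \<theta> \<alpha>"

text \<open>Since \<open>A i \<theta> j\<close> is at most 1, the series is dominated by that of
  \<open>\<alpha>\<close>. Only then does the real \<open>suminf\<close> defining \<open>b\<close>
  agree with the \<open>ennreal\<close> one.\<close>

lemma summable_terms: "summable (\<lambda>i. \<alpha> i * A i \<theta> j)"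
proof (rule summable_comparison_test)
  show "summable \<alpha>"
    using \<alpha> by (auto simp: weights_def sums_iff)
  show "\<exists>N. \<forall>i\<ge>N. norm (\<alpha> i * A i \<theta> j) \<le> \<alpha> i"
    using weights_nonneg[OF \<alpha>] weights_nonneg[OF A_weights] weights_le_1[OF A_weights]
    by (auto simp: abs_mult mult_left_le)
qed

lemma ennreal_b: "ennreal (b j) = (\<Sum>i. ennreal (\<alpha> i) * ennreal (A i \<theta> j))"
proof -
  have "ennreal (b j) = (\<Sum>i. ennreal (\<alpha> i * A i \<theta> j))"
    unfolding predict_weights_def
    using summable_terms weights_nonneg[OF \<alpha>] weights_nonneg[OF A_weights]
    by (intro suminf_ennreal2[symmetric]) auto
  then show ?thesis
    using weights_nonneg[OF \<alpha>] weights_nonneg[OF A_weights] by (simp add: ennreal_mult)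
qed

text \<open>After the interchange of sums each inner sum over \<open>j\<close> is 1, which leaves
  the total of \<open>\<alpha>\<close>.\<close>

lemma predict_weights_in_weights: "b \<in> weights"
proof -
  have "(\<Sum>j. ennreal (b j)) = (\<Sum>i. \<Sum>j. ennreal (\<alpha> i) * ennreal (A i \<theta> j))"
    unfolding ennreal_b by (rule suminf_swap_ennreal)
  also have "\<dots> = 1"
    using A_weights \<alpha> by (simp add: weights_iff_suminf)
  finally show ?thesis
    using suminf_nonneg[OF summable_terms] weights_nonneg[OF \<alpha>] weights_nonneg[OF A_weights]
    by (auto simp: weights_iff_suminf predict_weights_def)
qed

lemma emeasure_predict:
  assumes "sets \<eta> = sets X" "B \<in> sets X"
  shows "emeasure (predict P \<eta>) B = (\<integral>\<^sup>+x. emeasure (P x) B \<partial>\<eta>)"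
  unfolding predict_def
  using assms nonempty measurable_prob_algebraD[OF P_kernel] sets_eq_imp_space_eq[OF assms(1)]
  by (intro emeasure_bind[where N = X]) (auto cong: measurable_cong_sets)

lemma sets_predict:
  assumes "sets \<eta> = sets X"
  shows "sets (predict P \<eta>) = sets X"
  unfolding predict_def
proof (rule sets_bind)
  show "space \<eta> \<noteq> {}"
    using nonempty sets_eq_imp_space_eq[OF assms] by simp
  show "sets (P x) = sets X" if "x \<in> space \<eta>" for x
    using measurable_space[OF P_kernel, of x] that sets_eq_imp_space_eq[OF assms]
    by (simp add: space_prob_algebra)
qed

text \<open>Linearity reduces the prediction to the components, where (C2) applies. Interchanging
  the resulting double series collects the coefficient of \<open>\<nu> \<theta>' j\<close>, which is
  \<open>b j\<close>.\<close>

lemma predict_mixture: "predict P (mixture X \<nu> \<theta> \<alpha>) = mixture X \<nu> \<theta>' b"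
proof (rule measure_eqI)
  show "sets (predict P (mixture X \<nu> \<theta> \<alpha>)) = sets (mixture X \<nu> \<theta>' b)"
    by (simp add: sets_predict)
next
  fix B assume "B \<in> sets (predict P (mixture X \<nu> \<theta> \<alpha>))"
  then have B: "B \<in> sets X"
    by (simp add: sets_predict)
  have "emeasure (predict P (mixture X \<nu> \<theta> \<alpha>)) B
      = (\<integral>\<^sup>+x. emeasure (P x) B \<partial>mixture X \<nu> \<theta> \<alpha>)"
    using B by (simp add: emeasure_predict)
  also have "\<dots> = (\<Sum>i. ennreal (\<alpha> i) * (\<integral>\<^sup>+x. emeasure (P x) B \<partial>\<nu> \<theta> i))"
    using sets_\<nu>(1)
    by (rule nn_integral_mixture)
       (rule measurable_compose[OF measurable_prob_algebraD[OF P_kernel]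
          measurable_emeasure_subprob_algebra[OF B]])
  also have "\<dots> = (\<Sum>i. ennreal (\<alpha> i) * emeasure (predict P (\<nu> \<theta> i)) B)"
    using B sets_\<nu>(1) by (simp add: emeasure_predict)
  also have "\<dots> = (\<Sum>i. \<Sum>j. ennreal (\<alpha> i) * (ennreal (A i \<theta> j) * emeasure (\<nu> \<theta>' j) B))"
    using B sets_\<nu>(2) by (simp add: predict_\<nu> emeasure_mixture)
  also have "\<dots> = (\<Sum>j. \<Sum>i. ennreal (\<alpha> i) * (ennreal (A i \<theta> j) * emeasure (\<nu> \<theta>' j) B))"
    by (rule suminf_swap_ennreal)
  also have "\<dots> = (\<Sum>j. ennreal (b j) * emeasure (\<nu> \<theta>' j) B)"
    by (simp add: ennreal_b mult.assoc flip: ennreal_suminf_multc)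
  also have "\<dots> = emeasure (mixture X \<nu> \<theta>' b) B"
    using sets_\<nu>(2) B by (simp add: emeasure_mixture)
  finally show "emeasure (predict P (mixture X \<nu> \<theta> \<alpha>)) B = emeasure (mixture X \<nu> \<theta>' b) B" .
qed

text \<open>The series stops at \<open>N\<close> because \<open>\<alpha>\<close> vanishes beyond its
  length; the indicator only removes terms in which \<open>A i \<theta> j\<close> is already
  0.\<close>

lemma predict_weights_finite_sum:
  assumes "weight_length \<alpha> = enat N" and L: "\<And>i. weight_length (A i \<theta>) = enat (L i)"
  shows "b j = (\<Sum>i=0..N. \<alpha> i * A i \<theta> j * of_bool (j \<le> L i))"
proof -
  have "b j = (\<Sum>i=0..N. \<alpha> i * A i \<theta> j)"
    unfolding predict_weights_def
    using weight_length_eq_enat_zero[OF \<alpha> assms(1)] by (intro suminf_finite) auto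
  also have "\<dots> = (\<Sum>i=0..N. \<alpha> i * A i \<theta> j * of_bool (j \<le> L i))"
    using weight_length_eq_enat_zero[OF A_weights L] by (intro sum.cong) (auto simp: not_le)
  finally show ?thesis .
qed

text \<open>With \<open>L\<close> monotone, all indices \<open>i \<le> N\<close> have
  \<open>L i \<le> L N\<close>, so \<open>b\<close> vanishes beyond \<open>L N\<close>.\<close>

lemma weight_length_predict_finite:
  assumes "weight_length \<alpha> < \<infinity>" "\<And>i. weight_length (A i \<theta>) = enat (L i)" "mono L"
  shows "weight_length b < \<infinity>"
proof -
  obtain N where N: "weight_length \<alpha> = enat N"
    using assms(1) by (cases "weight_length \<alpha>") auto
  have "b j = 0" if "L N < j" for j
  proof -
    have "\<not> j \<le> L i" if "i \<le> N" for i
      using \<open>L N < j\<close> monoD[OF assms(3) that] by simp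
    then show ?thesis
      by (simp add: predict_weights_finite_sum[OF N assms(2)] del: sum_mult_of_bool_eq)
  qed
  then have "{j. b j > 0} \<subseteq> {..L N}"
    by (auto intro: leI)
  then show ?thesis
    unfolding weight_length_finite_iff by (rule finite_subset) simp
qed

end


text \<open>If the marginal density of a mixture is infinite, the update formula still holds, but
  both sides are the null measure, which is no mixture of probability measures. Hence the finiteness
  condition on membership in part 1.\<close>

theorem theorem2p1:
  fixes X :: "'x measure" and Y \<mu> :: "'y measure"
    and f :: "'x \<Rightarrow> 'y \<Rightarrow> real" and P :: "'x \<Rightarrow> 'x measure"
    and \<Theta> :: "(real ^ 'd) set" and \<nu> :: "real ^ 'd \<Rightarrow> nat \<Rightarrow> 'x measure"
    and T :: "'y \<Rightarrow> real ^ 'd \<Rightarrow> real ^ 'd" and t :: "'y \<Rightarrow> nat \<Rightarrow> nat"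
    and \<tau> :: "real ^ 'd \<Rightarrow> real ^ 'd" and A :: "nat \<Rightarrow> real ^ 'd \<Rightarrow> nat \<Rightarrow> real"
  assumes "hidden_markov_model X Y \<mu> f P"
    and "parametric_class X \<Theta> \<nu>"
    and "condition_C1 Y f \<Theta> \<nu> T t"
  shows
    "(condition_C2 X P \<Theta> \<nu> \<tau> A \<longrightarrow>
       (\<forall>\<eta>\<in>mixtures X \<Theta> \<nu>.
          (\<forall>y\<in>space Y. marginal_density f \<eta> y < \<infinity> \<longrightarrow> update f y \<eta> \<in> mixtures X \<Theta> \<nu>) \<and>
          predict P \<eta> \<in> mixtures X \<Theta> \<nu>) \<and>
       (\<forall>\<theta>\<in>\<Theta>. \<forall>\<alpha>\<in>weights.
          (\<forall>y\<in>space Y.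
             update f y (mixture X \<nu> \<theta> \<alpha>)
               = mixture X \<nu> (T y \<theta>) (update_weights X f \<nu> t y \<theta> \<alpha>) \<and>
             (marginal_density f (mixture X \<nu> \<theta> \<alpha>) y < \<infinity> \<longrightarrow>
               update_weights X f \<nu> t y \<theta> \<alpha> \<in> weights)) \<and>
          predict P (mixture X \<nu> \<theta> \<alpha>) = mixture X \<nu> (\<tau> \<theta>) (predict_weights A \<theta> \<alpha>) \<and>
          predict_weights A \<theta> \<alpha> \<in> weights) \<and>
       (\<forall>L. condition_C2f X P \<Theta> \<nu> \<tau> A L \<longrightarrow>
          (\<forall>\<theta>\<in>\<Theta>. \<forall>\<alpha>\<in>weights. \<forall>N. weight_length \<alpha> = enat N \<longrightarrow>
             (\<forall>j. predict_weights A \<theta> \<alpha> j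
                    = (\<Sum>i=0..N. \<alpha> i * A i \<theta> j * of_bool (j \<le> L i)) \<and>
                  predict_weights A \<theta> \<alpha> j
                    = (\<Sum>i | generalized_inverse L j \<le> enat i \<and> i \<le> N. \<alpha> i * A i \<theta> j)))))
     \<and>
     (\<forall>L. condition_C2f X P \<Theta> \<nu> \<tau> A L \<longrightarrow>
       (\<forall>\<eta>\<in>finite_mixtures X \<Theta> \<nu>.
          (\<forall>y\<in>space Y. update f y \<eta> \<in> finite_mixtures X \<Theta> \<nu>) \<and>
          predict P \<eta> \<in> finite_mixtures X \<Theta> \<nu>))"
proof -
  have P: "P \<in> X \<rightarrow>\<^sub>M prob_algebra X"
    and f: "(\<lambda>(x, y). f x y) \<in> borel_measurable (X \<Otimes>\<^sub>M Y)"
    using assms(1) by (auto simp: hidden_markov_model_def)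
  have \<nu>: "sets (\<nu> \<theta> i) = sets X" "prob_space (\<nu> \<theta> i)" if "\<theta> \<in> \<Theta>" for \<theta> i
    using parametric_class.prob[OF assms(2) that, of i] by (auto simp: space_prob_algebra)
  have T: "T y \<theta> \<in> \<Theta>" if "y \<in> space Y" "\<theta> \<in> \<Theta>" for y \<theta>
    using assms(3) that by (auto simp: condition_C1_def)
  have \<tau>: "\<tau> \<theta> \<in> \<Theta>" if "condition_C2 X P \<Theta> \<nu> \<tau> A" "\<theta> \<in> \<Theta>" for \<theta>
    using that by (auto simp: condition_C2_def)
  have upd: "updatable_mixture X f \<nu> t y \<theta> (T y \<theta>) \<alpha>"
    if "\<theta> \<in> \<Theta>" "\<alpha> \<in> weights" "y \<in> space Y" for \<theta> \<alpha> y
  proof (rule updatable_mixture.intro)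
    show "(\<lambda>x. f x y) \<in> borel_measurable X"
      using measurable_compose[OF measurable_Pair2'[OF that(3)] f] by simp
    show "inj (t y)" "\<And>i. update f y (\<nu> \<theta> i) = \<nu> (T y \<theta>) (t y i)"
      using assms(3) that by (simp_all add: condition_C1_def)
  qed (simp_all add: \<nu> T that)
  have pre: "predictable_mixture X P \<nu> A \<theta> (\<tau> \<theta>) \<alpha>"
    if "condition_C2 X P \<Theta> \<nu> \<tau> A" "\<theta> \<in> \<Theta>" "\<alpha> \<in> weights" for \<theta> \<alpha>
  proof (rule predictable_mixture.intro)
    \<comment> \<open>The space carries a probability measure, namely any component.\<close>
    show "space X \<noteq> {}"
      using prob_space.not_empty[OF \<nu>(2)] sets_eq_imp_space_eq[OF \<nu>(1)] that(2) by auto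
    show "A i \<theta> \<in> weights" "predict P (\<nu> \<theta> i) = mixture X \<nu> (\<tau> \<theta>) (A i \<theta>)" for i
      using that by (simp_all add: condition_C2_def)
  qed (simp_all add: \<nu> P \<tau> that)
  note update_facts = updatable_mixture.update_mixture[OF upd]
    updatable_mixture.update_weights_in_weights[OF upd]
  note predict_facts = predictable_mixture.predict_mixture[OF pre]
    predictable_mixture.predict_weights_in_weights[OF pre]
  have finite_sums:
    "predict_weights A \<theta> \<alpha> j = (\<Sum>i=0..N. \<alpha> i * A i \<theta> j * of_bool (j \<le> L i)) \<and>
     predict_weights A \<theta> \<alpha> j
       = (\<Sum>i | generalized_inverse L j \<le> enat i \<and> i \<le> N. \<alpha> i * A i \<theta> j)"
    if "condition_C2f X P \<Theta> \<nu> \<tau> A L" "\<theta> \<in> \<Theta>" "\<alpha> \<in> weights" "weight_length \<alpha> = enat N"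
    for L \<theta> \<alpha> N j
  proof
    have C2: "condition_C2 X P \<Theta> \<nu> \<tau> A" and L: "mono L" "\<And>i. weight_length (A i \<theta>) = enat (L i)"
      using that(1,2) by (auto simp: condition_C2f_def)
    show eq: "predict_weights A \<theta> \<alpha> j = (\<Sum>i=0..N. \<alpha> i * A i \<theta> j * of_bool (j \<le> L i))"
      using predictable_mixture.predict_weights_finite_sum[OF pre[OF C2 that(2,3)] that(4) L(2)] .
    show "predict_weights A \<theta> \<alpha> j
        = (\<Sum>i | generalized_inverse L j \<le> enat i \<and> i \<le> N. \<alpha> i * A i \<theta> j)"
      \<comment> \<open>The condition becomes \<open>j \<le> L i\<close>, and the indices left out
        have indicator 0.\<close>
      unfolding eq generalized_inverse_le_iff[OF L(1)]
      by (intro sum.mono_neutral_cong_right) auto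
  qed
  have update_mixtures: "update f y \<eta> \<in> mixtures X \<Theta> \<nu>"
    if "\<eta> \<in> mixtures X \<Theta> \<nu>" "y \<in> space Y" "marginal_density f \<eta> y < \<infinity>" for \<eta> y
    using that update_facts T unfolding mixtures_def by blast
  have predict_mixtures: "predict P \<eta> \<in> mixtures X \<Theta> \<nu>"
    if "condition_C2 X P \<Theta> \<nu> \<tau> A" "\<eta> \<in> mixtures X \<Theta> \<nu>" for \<eta>
    using that predict_facts[OF that(1)] \<tau> unfolding mixtures_def by blast
  \<comment> \<open>Finite length supplies the finite marginal density that normalises the new
    weights.\<close>
  have update_finite: "update f y \<eta> \<in> finite_mixtures X \<Theta> \<nu>"
    if "\<eta> \<in> finite_mixtures X \<Theta> \<nu>" "y \<in> space Y" for \<eta> y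
    using that update_facts T updatable_mixture.marginal_density_mixture_finite[OF upd]
      updatable_mixture.weight_length_update_finite[OF upd]
    unfolding finite_mixtures_def by blast
  have predict_finite: "predict P \<eta> \<in> finite_mixtures X \<Theta> \<nu>"
    if C2f: "condition_C2f X P \<Theta> \<nu> \<tau> A L" and mix: "\<eta> \<in> finite_mixtures X \<Theta> \<nu>" for \<eta> L
  proof -
    have C2: "condition_C2 X P \<Theta> \<nu> \<tau> A" and "mono L"
      and L: "\<And>i \<theta>. \<theta> \<in> \<Theta> \<Longrightarrow> weight_length (A i \<theta>) = enat (L i)"
      using C2f by (auto simp: condition_C2f_def)
    obtain \<theta> \<alpha> where \<eta>: "\<eta> = mixture X \<nu> \<theta> \<alpha>" "\<theta> \<in> \<Theta>" "\<alpha> \<in> weights" "weight_length \<alpha> < \<infinity>"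
      using mix by (auto simp: finite_mixtures_def)
    have "weight_length (predict_weights A \<theta> \<alpha>) < \<infinity>"
      using predictable_mixture.weight_length_predict_finite[OF pre[OF C2 \<eta>(2,3)] \<eta>(4) L \<open>mono L\<close>]
        \<eta>(2) by simp
    then show ?thesis
      using predict_facts[OF C2 \<eta>(2,3)] \<tau>[OF C2 \<eta>(2)] unfolding finite_mixtures_def \<eta>(1) by blast
  qed
  show ?thesis
    by (intro conjI impI allI ballI;
        rule update_facts predict_facts finite_sums[THEN conjunct1] finite_sums[THEN conjunct2]
          update_mixtures predict_mixtures update_finite predict_finite;
        assumption)
qed

end
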